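(* Let $G$ be a connected simple graph with biconnected decomposition with oddments $G_0,B_1,\dots,B_{r'}$. Then the Ehrhart series of $G$ factors as $H_G(t)=H_{G_0}(t)\prod_{i=1}^{r'}H_{B_i}(t)$.
   Context: For a graph $H$ with vertices $v_1,\dots,v_n$, its edge polytope is $\mathcal{P}_H=\mathrm{conv}\{\mathbf{e}_i+\mathbf{e}_j:\{v_i,v_j\}\text{ an edge}\}\subset\mathbb{R}^n$ and its Ehrhart series is $H_H(t)=\sum_{m\ge0}|m\mathcal{P}_H\cap\mathbb{Z}^n|t^m$ (with the $m=0$ term equal to $1$). Biconnected decomposition with oddments: let $B_1,\dots,B_r$ be the biconnected components (blocks) of $G$; let $G_0$ be the minimum connected subgraph of $G$ containing all blocks that contain an odd cycle; after renumbering, $B_1,\dots,B_{r'}$ are the blocks not contained in $G_0$, so that $G$ decomposes as $G_0,B_1,\dots,B_{r'}$. (If $G$ has no odd cycle, $G_0$ is empty and $H_{G_0}(t)$ is read as $1$.)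
   Formalization: G_0 is taken as the least connected union of whole blocks containing all blocks with an odd cycle; among arbitrary connected subgraphs a minimum need not exist (two triangles attached at opposite vertices of a 4-cycle). *)

theory Defs
  imports
    "HOL-Analysis.Analysis"
    "HOL-Computational_Algebra.Formal_Power_Series"
    "Graph_Theory.Graph_Theory"
begin

text \<open>
  Finite simple graphs are the symmetric digraphs of the locale \<^locale>\<open>graph\<close>: an undirected
  edge is a pair of opposite arcs. A subgraph of a graph in the undirected sense is a
  \<^const>\<open>subgraph\<close> that again satisfies \<^const>\<open>graph\<close>.
\<close>

text \<open>
  The two arcs of an edge yield the same generator. All subgraphs of a graph on the vertex type
  \<open>'v\<close> get their polytope in the same space \<open>real ^ 'v\<close>; the coordinates of vertices
  outside \<open>H\<close> vanish on the polytope of \<open>H\<close>, so lattice points are counted as in the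
  coordinate subspace spanned by the vertices of \<open>H\<close>.
\<close>

definition edge_polytope :: "('v::finite, 'e) pre_digraph \<Rightarrow> (real ^ 'v) set" where
  "edge_polytope H = convex hull {axis (tail H e) 1 + axis (head H e) 1 | e. e \<in> arcs H}"

text \<open>
  The constant coefficient is 1 also for the empty polytope, so a graph without edges has
  Ehrhart series 1.
\<close>

definition ehrhart_series :: "(real ^ 'v::finite) set \<Rightarrow> int fps" where
  "ehrhart_series P = Abs_fps (\<lambda>m. if m = 0 then 1
     else int (card {x \<in> (\<lambda>p. real m *\<^sub>R p) ` P. \<forall>i. x $ i \<in> \<int>}))"

definition graph_ehrhart_series :: "('v::finite, 'e) pre_digraph \<Rightarrow> int fps" where
  "graph_ehrhart_series H = ehrhart_series (edge_polytope H)"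

text \<open>
  The one-edge graph is biconnected, so bridges are blocks; the one-vertex graph is a block only
  as an isolated vertex.
\<close>

definition biconnected :: "('v, 'e) pre_digraph \<Rightarrow> bool" where
  "biconnected H \<longleftrightarrow> graph H \<and> Digraph_Component.connected H \<and>
     (\<forall>v \<in> verts H. verts H - {v} \<noteq> {} \<longrightarrow>
        Digraph_Component.connected (H \<restriction> (verts H - {v})))"

definition blocks :: "('v, 'e) pre_digraph \<Rightarrow> ('v, 'e) pre_digraph set" where
  "blocks G = {B. pre_digraph.max_subgraph G biconnected B}"

text \<open>
  The library also counts traversing one edge back and forth as a cycle, but that has length 2, so
  in a graph the odd cycles are exactly the usual ones.
\<close>

definition has_odd_cycle :: "('v, 'e) pre_digraph \<Rightarrow> bool" where
  "has_odd_cycle H \<longleftrightarrow> (\<exists>p. pre_digraph.cycle H p \<and> odd (length p))"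

text \<open>
  The minimum defining the oddment part is taken among connected subgraphs composed of whole
  blocks. Among arbitrary connected subgraphs a minimum need not exist (two triangles joined through
  opposite corners of a 4-cycle), and the graph would not decompose into it and the remaining
  blocks.
\<close>

definition connected_odd_block_unions :: "('v, 'e) pre_digraph \<Rightarrow> ('v, 'e) pre_digraph set" where
  "connected_odd_block_unions G =
     {K. (\<exists>\<B> \<subseteq> blocks G. K = pre_digraph.Union G \<B>) \<and> Digraph_Component.connected K \<and>
         (\<forall>B \<in> blocks G. has_odd_cycle B \<longrightarrow> subgraph B K)}"

definition is_oddment_part :: "('v, 'e) pre_digraph \<Rightarrow> ('v, 'e) pre_digraph \<Rightarrow> bool" where
  "is_oddment_part G G\<^sub>0 \<longleftrightarrow>
     (if has_odd_cycle G
      then G\<^sub>0 \<in> connected_odd_block_unions G \<and>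
           (\<forall>K \<in> connected_odd_block_unions G. subgraph G\<^sub>0 K)
      else G\<^sub>0 = pre_digraph.Union G {})"

definition biconnected_decomposition_with_oddments ::
  "('v, 'e) pre_digraph \<Rightarrow> ('v, 'e) pre_digraph \<Rightarrow> ('v, 'e) pre_digraph set \<Rightarrow> bool" where
  "biconnected_decomposition_with_oddments G G\<^sub>0 Bs \<longleftrightarrow>
     is_oddment_part G G\<^sub>0 \<and> Bs = {B \<in> blocks G. \<not> subgraph B G\<^sub>0}"

end

theory Submission
  imports Defs
begin

text \<open>
  If two graphs share a single vertex and one of them is bipartite, an integer point of the
  dilated edge polytope of their union splits uniquely into points of dilates of the two parts,
  and the parts are again integral with integral dilation factors; hence the Ehrhart series
  multiply. A graph whose blocks outside \<open>G\<^sub>0\<close> have no odd cycle arises from \<open>G\<^sub>0\<close> by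
  attaching these bipartite blocks one after the other, each at a single vertex.
\<close>

section \<open>Lattice points of dilated edge polytopes\<close>

text \<open>Points of dilated polytopes are handled through real arc weights, because weights on a
  union restrict to weights on its parts. The obstacle is that an integral point may come with
  non-integral weights. In two triangles sharing a vertex, weight 1/2 on each edge gives an integral
  point of the third dilate (entry 2 at the shared vertex, 1 elsewhere). It splits with total
  weights 3/2 and 3/2, but also with 2 and 1. So with odd cycles on both sides the split can fail to
  be unique and to be integral, which is why the odd blocks and whatever links them stay together in
  \<open>G\<^sub>0\<close>. The order of attachment is not fixed in advance: any connected union
  that misses some block can be extended by a block touching it, and connectedness of the union is
  what limits the contact to one vertex.\<close>

definition edge_dilation :: "('v::finite, 'e) pre_digraph \<Rightarrow> real \<Rightarrow> (real ^ 'v) set" where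
  "edge_dilation H r =
    {(\<Sum>e\<in>arcs H. w e *\<^sub>R (axis (tail H e) 1 + axis (head H e) 1)) | w.
      (\<forall>e. 0 \<le> w e) \<and> sum w (arcs H) = r}"

definition dilation_points :: "('v::finite, 'e) pre_digraph \<Rightarrow> nat \<Rightarrow> (real ^ 'v) set" where
  "dilation_points H m = {x \<in> edge_dilation H (real m). \<forall>i. x $ i \<in> \<int>}"

text \<open>Opposite arcs give the same generator, so weights indexed by arcs are not weights
  indexed by points. Minimality of the hull avoids choosing one arc per edge.\<close>

lemma edge_dilation_1:
  assumes "finite (arcs H)"
  shows "edge_dilation H 1 = edge_polytope H"
proof
  let ?g = "\<lambda>e. axis (tail H e) 1 + axis (head H e) (1::real)"
  show "edge_dilation H 1 \<subseteq> edge_polytope H"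
    unfolding edge_dilation_def edge_polytope_def
    by (safe, rule convex_sum) (auto simp: assms intro: hull_inc)
  show "edge_polytope H \<subseteq> edge_dilation H 1"
    unfolding edge_polytope_def
  proof (rule hull_minimal)
    show "{?g e |e. e \<in> arcs H} \<subseteq> edge_dilation H 1"
    proof safe
      fix e assume e: "e \<in> arcs H"
      have "?g e = (\<Sum>f\<in>arcs H. of_bool (f = e) *\<^sub>R ?g f)" "(\<Sum>f\<in>arcs H. of_bool (f = e)) = (1::real)"
        using e assms by (simp_all add: of_bool_def if_distrib[of "\<lambda>c. c *\<^sub>R _"] cong: if_cong)
      then show "?g e \<in> edge_dilation H 1"
        unfolding edge_dilation_def
        by (intro CollectI exI[of _ "\<lambda>f. of_bool (f = e)"]) auto
    qed
    show "convex (edge_dilation H 1)"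
    proof (rule convexI)
      fix x y and u v :: real
      assume xy: "x \<in> edge_dilation H 1" "y \<in> edge_dilation H 1"
        and uv: "0 \<le> u" "0 \<le> v" "u + v = 1"
      from xy obtain a b where
        a: "\<forall>e. 0 \<le> a e" "sum a (arcs H) = 1" "x = (\<Sum>e\<in>arcs H. a e *\<^sub>R ?g e)" and
        b: "\<forall>e. 0 \<le> b e" "sum b (arcs H) = 1" "y = (\<Sum>e\<in>arcs H. b e *\<^sub>R ?g e)"
        unfolding edge_dilation_def by auto
      have "(\<Sum>e\<in>arcs H. u * a e + v * b e) = 1"
        using a b uv by (simp add: sum.distrib flip: sum_distrib_left)
      moreover have "u *\<^sub>R x + v *\<^sub>R y = (\<Sum>e\<in>arcs H. (u * a e + v * b e) *\<^sub>R ?g e)"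
        unfolding a b by (simp add: scaleR_sum_right scaleR_add_left sum.distrib)
      ultimately show "u *\<^sub>R x + v *\<^sub>R y \<in> edge_dilation H 1"
        using a b uv unfolding edge_dilation_def
        by (intro CollectI exI[of _ "\<lambda>e. u * a e + v * b e"]) auto
    qed
  qed
qed

lemma edge_dilation_scale:
  assumes "r > 0"
  shows "edge_dilation H r = (\<lambda>p. r *\<^sub>R p) ` edge_dilation H 1"
proof
  let ?g = "\<lambda>e. axis (tail H e) 1 + axis (head H e) (1::real)"
  show "edge_dilation H r \<subseteq> (\<lambda>p. r *\<^sub>R p) ` edge_dilation H 1"
  proof
    fix x assume "x \<in> edge_dilation H r"
    then obtain w where w: "\<forall>e. 0 \<le> w e" "sum w (arcs H) = r" "x = (\<Sum>e\<in>arcs H. w e *\<^sub>R ?g e)"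
      unfolding edge_dilation_def by auto
    have "x = r *\<^sub>R (\<Sum>e\<in>arcs H. (w e / r) *\<^sub>R ?g e)"
      using assms by (simp add: w(3) scaleR_sum_right)
    moreover have "(\<Sum>e\<in>arcs H. (w e / r) *\<^sub>R ?g e) \<in> edge_dilation H 1"
      unfolding edge_dilation_def using assms w
      by (intro CollectI exI[of _ "\<lambda>e. w e / r"]) (auto simp flip: sum_divide_distrib)
    ultimately show "x \<in> (\<lambda>p. r *\<^sub>R p) ` edge_dilation H 1" by blast
  qed
  show "(\<lambda>p. r *\<^sub>R p) ` edge_dilation H 1 \<subseteq> edge_dilation H r"
  proof safe
    fix x assume "x \<in> edge_dilation H 1"
    then obtain w where w: "\<forall>e. 0 \<le> w e" "sum w (arcs H) = 1" "x = (\<Sum>e\<in>arcs H. w e *\<^sub>R ?g e)"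
      unfolding edge_dilation_def by auto
    show "r *\<^sub>R x \<in> edge_dilation H r"
      unfolding edge_dilation_def using assms w
      by (intro CollectI exI[of _ "\<lambda>e. r * w e"]) (auto simp: scaleR_sum_right simp flip: sum_distrib_left)
  qed
qed

text \<open>Total weight 0 forces all weights to vanish, so the zeroth dilation is {0} even for a
  graph without arcs. This reproduces the constant coefficient 1 and gives one formula for all
  \<open>m\<close>, as a Cauchy product requires.\<close>

lemma graph_ehrhart_series_conv:
  assumes "finite (arcs H)"
  shows "graph_ehrhart_series H = Abs_fps (\<lambda>m. int (card (dilation_points H m)))"
proof -
  have "x = 0" if x: "x \<in> edge_dilation H 0" for x
  proof -
    obtain w where w: "\<forall>e. 0 \<le> w e" "sum w (arcs H) = 0"
      "x = (\<Sum>e\<in>arcs H. w e *\<^sub>R (axis (tail H e) 1 + axis (head H e) 1))"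
      using x unfolding edge_dilation_def by auto
    have "w e = 0" if "e \<in> arcs H" for e
      using w(1,2) assms that by (simp add: sum_nonneg_eq_0_iff)
    then show ?thesis unfolding w(3) by simp
  qed
  moreover have "0 \<in> edge_dilation H 0"
    unfolding edge_dilation_def by (intro CollectI exI[of _ "\<lambda>_. 0"]) simp
  ultimately have 0: "dilation_points H 0 = {0}"
    unfolding dilation_points_def by auto
  have "dilation_points H m = {x \<in> (\<lambda>p. real m *\<^sub>R p) ` edge_polytope H. \<forall>i. x $ i \<in> \<int>}" if "m > 0" for m
    unfolding dilation_points_def
    using that edge_dilation_scale[of "real m" H] edge_dilation_1[OF assms] by simp
  with 0 show ?thesis
    unfolding graph_ehrhart_series_def ehrhart_series_def by (intro arg_cong[of _ _ Abs_fps] ext) simp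
qed

lemma edge_dilation_support:
  assumes "wf_digraph H" "x \<in> edge_dilation H r" "i \<notin> verts H"
  shows "x $ i = 0"
proof -
  interpret wf_digraph H by fact
  show ?thesis
    using assms(2,3) tail_in_verts head_in_verts unfolding edge_dilation_def
    by (auto simp: axis_def intro!: sum.neutral)
qed

text \<open>Generators have entries between 0 and 2, with 2 only for a loop, so total weight
  \<open>m\<close> confines each coordinate to [0, 2m]. Finiteness is what lets \<open>card\<close>
  turn a disjoint union of products into a sum.\<close>

lemma finite_dilation_points: "finite (dilation_points H m)"
proof -
  let ?F = "(\<lambda>f. \<chi> i. real_of_int (f i)) ` (UNIV \<rightarrow>\<^sub>E {0..2 * int m})"
  have "dilation_points H m \<subseteq> ?F"
  proof
    fix x assume x: "x \<in> dilation_points H m"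
    then obtain w where w: "\<forall>e. 0 \<le> w e" "sum w (arcs H) = real m"
      "x = (\<Sum>e\<in>arcs H. w e *\<^sub>R (axis (tail H e) 1 + axis (head H e) 1))"
      unfolding dilation_points_def edge_dilation_def by auto
    have lo: "0 \<le> x $ i" for i
      unfolding w(3) using w(1) by (auto simp: axis_def intro!: sum_nonneg)
    have "x $ i \<le> (\<Sum>e\<in>arcs H. w e * 2)" for i
      unfolding w(3) using w(1) by (auto simp: axis_def intro!: sum_mono)
    then have hi: "x $ i \<le> 2 * real m" for i
      using w(2) by (simp add: mult.commute flip: sum_distrib_right)
    have int: "x $ i = real_of_int \<lfloor>x $ i\<rfloor>" for i
      using x unfolding dilation_points_def by auto
    have "\<lfloor>x $ i\<rfloor> \<in> {0..2 * int m}" for i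
      using lo[of i] hi[of i] by (subst (asm) (1 2) int) auto
    then show "x \<in> ?F"
      using int by (intro image_eqI[of _ _ "\<lambda>i. \<lfloor>x $ i\<rfloor>"]) (auto simp: vec_eq_iff)
  qed
  then show ?thesis
    by (rule finite_subset) (auto intro!: finite_imageI finite_PiE)
qed

text \<open>Each arc has exactly one end in the class \<open>c\<close>, so its weight is counted
  exactly once. The lemma is later applied to both classes, described relative to the colour of the
  shared vertex.\<close>

lemma edge_dilation_colour_class_sum:
  assumes "wf_digraph H" "x \<in> edge_dilation H r"
    and c: "\<And>e. e \<in> arcs H \<Longrightarrow> c (tail H e) \<noteq> c (head H e)"
  shows "(\<Sum>i | i \<in> verts H \<and> c i. x $ i) = r"
proof -
  interpret wf_digraph H by fact
  obtain w where w: "sum w (arcs H) = r"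
    "x = (\<Sum>e\<in>arcs H. w e *\<^sub>R (axis (tail H e) 1 + axis (head H e) 1))"
    using assms(2) unfolding edge_dilation_def by auto
  have "(\<Sum>i | i \<in> verts H \<and> c i. x $ i) =
      (\<Sum>e\<in>arcs H. w e * (\<Sum>i | i \<in> verts H \<and> c i. of_bool (tail H e = i) + of_bool (head H e = i)))"
    unfolding w(2) sum_component sum_distrib_left
    by (subst sum.swap) (auto simp: axis_def intro!: sum.cong)
  also have "\<dots> = (\<Sum>e\<in>arcs H. w e * 1)"
  proof (intro sum.cong refl arg_cong2[of _ _ _ _ "(*)"])
    fix e assume "e \<in> arcs H"
    then show "(\<Sum>i | i \<in> verts H \<and> c i. of_bool (tail H e = i) + of_bool (head H e = i)) = (1::real)"
      using c[of e] by (auto simp: sum.distrib of_bool_def)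
  qed
  finally show ?thesis using w(1) by simp
qed

text \<open>
  Both colour classes of a bipartite graph carry the full weight of a point of the dilation. So for
  a sum over two graphs sharing the vertex \<open>v\<close>, the class avoiding \<open>v\<close> reveals the dilation
  factor of the bipartite summand, and the other class then reveals its coordinate at \<open>v\<close>.
\<close>

lemma card_dilation_points_glue:
  fixes H H1 H2 :: "('v::finite, 'e) pre_digraph"
  assumes wf: "wf_digraph H1" "wf_digraph H2"
    and fin: "finite (arcs H1)" "finite (arcs H2)"
    and comp: "compatible H H1" "compatible H H2"
    and arcs: "arcs H = arcs H1 \<union> arcs H2"
    and v: "verts H1 \<inter> verts H2 \<subseteq> {v}" "v \<in> verts H2"
    and col: "\<And>e. e \<in> arcs H2 \<Longrightarrow> c (tail H2 e) \<noteq> (c (head H2 e) :: bool)"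
  shows "card (dilation_points H m) =
    (\<Sum>k\<le>m. card (dilation_points H2 k) * card (dilation_points H1 (m - k)))"
proof -
  interpret H1: wf_digraph H1 by fact
  interpret H2: wf_digraph H2 by fact
  define g where "g e = axis (tail H e) 1 + axis (head H e) (1::real)" for e
  have dil: "edge_dilation H r = {(\<Sum>e\<in>arcs H. w e *\<^sub>R g e) | w. (\<forall>e. 0 \<le> w e) \<and> sum w (arcs H) = r}"
    "edge_dilation H1 r = {(\<Sum>e\<in>arcs H1. w e *\<^sub>R g e) | w. (\<forall>e. 0 \<le> w e) \<and> sum w (arcs H1) = r}"
    "edge_dilation H2 r = {(\<Sum>e\<in>arcs H2. w e *\<^sub>R g e) | w. (\<forall>e. 0 \<le> w e) \<and> sum w (arcs H2) = r}" for r
    using comp unfolding edge_dilation_def g_def compatible_def by auto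
  \<comment> \<open>A common arc would have both ends in the shared vertex, hence be a loop, and the
    colouring of \<open>H2\<close> forbids loops.\<close>
  have disj: "arcs H1 \<inter> arcs H2 = {}"
  proof (rule ccontr)
    assume "arcs H1 \<inter> arcs H2 \<noteq> {}"
    then obtain e where e: "e \<in> arcs H1" "e \<in> arcs H2" by blast
    then have "tail H e = v" "head H e = v"
      using subsetD[OF v(1)] H1.wellformed[OF e(1)] H2.wellformed[OF e(2)] comp
      unfolding compatible_def by (metis IntI singletonD)+
    with col[OF e(2)] comp show False unfolding compatible_def by auto
  qed
  \<comment> \<open>\<open>K\<close> (the dilation factor of the \<open>H2\<close> part) and
    \<open>Z\<close> (that part itself) are computed from \<open>x\<close> alone, by sums and
    differences of its coordinates. The same formulas therefore yield uniqueness of the split, via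
    \<open>recover\<close>, and integrality of both parts.\<close>
  define K where "K x = (\<Sum>i | i \<in> verts H2 \<and> c i \<noteq> c v. x $ i)" for x :: "real ^ 'v"
  define Z where "Z x = (\<chi> i. if i = v then K x - (\<Sum>i | i \<in> verts H2 \<and> c i = c v \<and> i \<noteq> v. x $ i)
      else if i \<in> verts H2 then x $ i else 0)" for x :: "real ^ 'v"
  have recover: "K (y + z) = k" "Z (y + z) = z"
    if y: "y \<in> edge_dilation H1 j" and z: "z \<in> edge_dilation H2 k" for y z j k
  proof -
    have y0: "y $ i = 0" if "i \<in> verts H2" "i \<noteq> v" for i
      using edge_dilation_support[OF wf(1) y, of i] that v(1) by auto
    have "K (y + z) = (\<Sum>i | i \<in> verts H2 \<and> c i \<noteq> c v. z $ i)"
      unfolding K_def by (intro sum.cong refl) (use y0 in force)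
    also have "\<dots> = k"
      using col by (intro edge_dilation_colour_class_sum[OF wf(2) z]) auto
    finally show K: "K (y + z) = k" .
    have "k = (\<Sum>i | i \<in> verts H2 \<and> c i = c v. z $ i)"
      using col by (intro edge_dilation_colour_class_sum[OF wf(2) z, symmetric]) auto
    also have "\<dots> = z $ v + (\<Sum>i\<in>{i. i \<in> verts H2 \<and> c i = c v} - {v}. z $ i)"
      using v(2) by (intro sum.remove) auto
    also have "(\<Sum>i\<in>{i. i \<in> verts H2 \<and> c i = c v} - {v}. z $ i) =
        (\<Sum>i | i \<in> verts H2 \<and> c i = c v \<and> i \<noteq> v. (y + z) $ i)"
      by (intro sum.cong) (auto simp: y0)
    finally have "Z (y + z) $ v = z $ v"
      unfolding Z_def by (simp add: K)
    moreover have "Z (y + z) $ i = z $ i" if "i \<noteq> v" for i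
      using that edge_dilation_support[OF wf(2) z, of i] unfolding Z_def by (simp add: y0)
    ultimately show "Z (y + z) = z"
      by (metis vec_eq_iff)
  qed
  \<comment> \<open>The cardinality of \<open>X\<close> is the coefficient of the Cauchy product, so
    a bijection from \<open>X\<close> by addition suffices.\<close>
  define X where "X = Sigma {..m} (\<lambda>k. dilation_points H2 k \<times> dilation_points H1 (m - k))"
  have "inj_on (\<lambda>(k, z, y). y + z) X"
  proof (rule inj_onI, safe)
    fix k z y k' z' y'
    assume "(k, z, y) \<in> X" "(k', z', y') \<in> X" and eq: "y + z = y' + z'"
    then have "z \<in> edge_dilation H2 k" "z' \<in> edge_dilation H2 k'"
      "y \<in> edge_dilation H1 (m - k)" "y' \<in> edge_dilation H1 (m - k')"
      unfolding X_def dilation_points_def by auto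
    from recover[OF this(3,1)] recover[OF this(4,2)]
    have "real k = real k'" "z = z'" by (simp_all add: eq)
    with eq show "k = k'" "z = z'" "y = y'" by auto
  qed
  moreover have "(\<lambda>(k, z, y). y + z) ` X = dilation_points H m"
  proof (intro equalityI subsetI)
    fix x assume "x \<in> (\<lambda>(k, z, y). y + z) ` X"
    then obtain k y z where x: "x = y + z" and k: "k \<le> m"
      and y: "y \<in> dilation_points H1 (m - k)" and z: "z \<in> dilation_points H2 k"
      unfolding X_def by auto
    from y z obtain a b where
      a: "\<forall>e. 0 \<le> a e" "sum a (arcs H1) = real (m - k)" "y = (\<Sum>e\<in>arcs H1. a e *\<^sub>R g e)" and
      b: "\<forall>e. 0 \<le> b e" "sum b (arcs H2) = real k" "z = (\<Sum>e\<in>arcs H2. b e *\<^sub>R g e)"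
      unfolding dilation_points_def dil by auto
    define w where "w e = (if e \<in> arcs H1 then a e else b e)" for e
    have "sum w (arcs H1) = sum a (arcs H1)" "sum w (arcs H2) = sum b (arcs H2)"
      "(\<Sum>e\<in>arcs H1. w e *\<^sub>R g e) = y" "(\<Sum>e\<in>arcs H2. w e *\<^sub>R g e) = z"
      unfolding a(3) b(3) w_def using disj by (auto intro!: sum.cong)
    then have "x = (\<Sum>e\<in>arcs H. w e *\<^sub>R g e)" "sum w (arcs H) = real m" "\<forall>e. 0 \<le> w e"
      using a b k unfolding x arcs by (auto simp: sum.union_disjoint fin disj w_def)
    then have "x \<in> edge_dilation H m" unfolding dil by blast
    with y z show "x \<in> dilation_points H m"
      unfolding dilation_points_def x by auto
  next
    fix x assume "x \<in> dilation_points H m"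
    then obtain w where w: "\<forall>e. 0 \<le> w e" "sum w (arcs H) = real m" "x = (\<Sum>e\<in>arcs H. w e *\<^sub>R g e)"
      and int: "x $ i \<in> \<int>" for i
      unfolding dilation_points_def dil by auto
    define y z where "y = (\<Sum>e\<in>arcs H1. w e *\<^sub>R g e)" and "z = (\<Sum>e\<in>arcs H2. w e *\<^sub>R g e)"
    \<comment> \<open>These totals are real a priori. That \<open>k\<close> is a natural number
      follows from \<open>k\<close> = \<open>K x\<close>, an integer combination of the coordinates
      of \<open>x\<close>; then \<open>j\<close> is one too.\<close>
    define j k where "j = sum w (arcs H1)" and "k = sum w (arcs H2)"
    have x: "x = y + z" and jk: "j + k = real m"
      using w unfolding arcs y_def z_def j_def k_def by (auto simp: sum.union_disjoint fin disj)
    have y: "y \<in> edge_dilation H1 j" and z: "z \<in> edge_dilation H2 k"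
      using w(1) unfolding dil y_def z_def j_def k_def by auto
    have K: "K x \<in> \<int>"
      unfolding K_def by (intro Ints_sum int)
    have nonneg: "0 \<le> j" "0 \<le> k"
      unfolding j_def k_def using w(1) by (auto intro: sum_nonneg)
    with K obtain n where n: "k = real n"
      unfolding x recover[OF y z] by (metis Ints_cases nonneg_int_cases of_int_0_le_iff of_int_of_nat_eq)
    have "Z x $ i \<in> \<int>" for i
      using K int by (auto simp: Z_def intro!: Ints_sum Ints_diff)
    then have z_int: "z $ i \<in> \<int>" for i
      unfolding x recover[OF y z] .
    have y_int: "y $ i \<in> \<int>" for i
      using Ints_diff[OF int[of i] z_int[of i]] unfolding x by simp
    have "n \<le> m" "j = real (m - n)"
      using jk nonneg n by auto
    then have "(n, z, y) \<in> X"
      using y z y_int z_int n unfolding X_def dilation_points_def by auto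
    then show "x \<in> (\<lambda>(k, z, y). y + z) ` X"
      unfolding x by force
  qed
  ultimately have "card (dilation_points H m) = card X"
    by (metis card_image)
  also have "\<dots> = (\<Sum>k\<le>m. card (dilation_points H2 k) * card (dilation_points H1 (m - k)))"
    unfolding X_def by (simp add: finite_dilation_points card_cartesian_product)
  finally show ?thesis .
qed

lemma graph_ehrhart_series_glue:
  fixes H H1 H2 :: "('v::finite, 'e) pre_digraph"
  assumes "wf_digraph H1" "wf_digraph H2" "finite (arcs H1)" "finite (arcs H2)"
    "compatible H H1" "compatible H H2" "arcs H = arcs H1 \<union> arcs H2"
    "verts H1 \<inter> verts H2 \<subseteq> {v}" "v \<in> verts H2"
    "\<And>e. e \<in> arcs H2 \<Longrightarrow> c (tail H2 e) \<noteq> (c (head H2 e) :: bool)"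
  shows "graph_ehrhart_series H = graph_ehrhart_series H1 * graph_ehrhart_series H2"
proof (rule fps_ext)
  fix m
  have "finite (arcs H)" using assms by simp
  then have "fps_nth (graph_ehrhart_series H) m = fps_nth (graph_ehrhart_series H2 * graph_ehrhart_series H1) m"
    using card_dilation_points_glue[of H1 H2 H v c m, OF assms] assms(3,4)
    by (simp add: graph_ehrhart_series_conv fps_mult_nth atLeast0AtMost)
  then show "fps_nth (graph_ehrhart_series H) m = fps_nth (graph_ehrhart_series H1 * graph_ehrhart_series H2) m"
    by (simp add: mult.commute)
qed

section \<open>Blocks\<close>

text \<open>Blocks will turn out to be induced subgraphs, so maximality can be argued on vertex sets
  with one fixed relation. The empty set counts as connected here, unlike for
  \<open>Digraph_Component.connected\<close>.\<close>

definition conn_on :: "'a rel \<Rightarrow> 'a set \<Rightarrow> bool" where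
  "conn_on E S \<longleftrightarrow> (\<forall>u\<in>S. \<forall>v\<in>S. (u, v) \<in> rtrancl_on S E)"

text \<open>Letting \<open>v\<close> range over everything is harmless: deleting a point outside
  \<open>S\<close> changes nothing, and deleting the only point leaves the connected empty set. The
  side conditions of \<open>biconnected\<close> thus disappear.\<close>

definition bic_on :: "'a rel \<Rightarrow> 'a set \<Rightarrow> bool" where
  "bic_on E S \<longleftrightarrow> S \<noteq> {} \<and> conn_on E S \<and> (\<forall>v. conn_on E (S - {v}))"

lemma conn_on_mono: "conn_on E S \<Longrightarrow> E \<subseteq> F \<Longrightarrow> conn_on F S"
  unfolding conn_on_def by (blast intro: rtrancl_on_mono[of E F S S])

lemma bic_on_mono: "bic_on E S \<Longrightarrow> E \<subseteq> F \<Longrightarrow> bic_on F S"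
  unfolding bic_on_def by (blast intro: conn_on_mono)

lemma conn_on_Un:
  assumes "conn_on E A" "conn_on E B" "A \<inter> B \<noteq> {}"
  shows "conn_on E (A \<union> B)"
proof -
  obtain w where w: "w \<in> A" "w \<in> B" using assms(3) by blast
  have "(u, w) \<in> rtrancl_on (A \<union> B) E \<and> (w, u) \<in> rtrancl_on (A \<union> B) E" if "u \<in> A \<union> B" for u
    using that w assms(1,2) unfolding conn_on_def
    by (blast intro: rtrancl_on_mono[of E E A "A \<union> B"] rtrancl_on_mono[of E E B "A \<union> B"])
  then show ?thesis
    unfolding conn_on_def by (blast intro: rtrancl_on_trans)
qed

lemma conn_on_empty: "conn_on E {}"
  unfolding conn_on_def by simp

lemma conn_on_singleton: "conn_on E {x}"
  unfolding conn_on_def by auto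

lemma conn_on_edge: "sym E \<Longrightarrow> (x, y) \<in> E \<Longrightarrow> conn_on E {x, y}"
  unfolding conn_on_def
  by (auto intro: rtrancl_on_into_rtrancl_on[OF rtrancl_on_refl] dest: symD)

lemma conn_on_path:
  assumes "sym E" "successively (\<lambda>x y. (x, y) \<in> E) xs"
  shows "conn_on E (set xs)"
  using assms(2)
proof (induction xs rule: induct_list012)
  case (3 x y zs)
  then have "conn_on E ({x, y} \<union> set (y # zs))"
    by (intro conn_on_Un conn_on_edge assms) auto
  then show ?case by (simp add: insert_commute)
qed (simp_all add: conn_on_empty conn_on_singleton)

text \<open>If the new start already lies on the path, everything before that occurrence is dropped.
  Distinctness matters later: deleting a vertex must leave only the stretch before it and the
  stretch after it.\<close>

lemma rtrancl_on_simple_path: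
  assumes "(u, v) \<in> rtrancl_on S E"
  obtains xs where "xs \<noteq> []" "hd xs = u" "last xs = v" "distinct xs" "set xs \<subseteq> S"
    "successively (\<lambda>x y. (x, y) \<in> E) xs"
proof -
  have "\<exists>xs. xs \<noteq> [] \<and> hd xs = u \<and> last xs = v \<and> distinct xs \<and> set xs \<subseteq> S \<and>
    successively (\<lambda>x y. (x, y) \<in> E) xs"
    using assms
  proof (induction rule: converse_rtrancl_on_induct)
    case base
    then show ?case by (intro exI[of _ "[v]"]) auto
  next
    case (step x y)
    then obtain xs where xs: "xs \<noteq> []" "hd xs = y" "last xs = v" "distinct xs" "set xs \<subseteq> S"
      "successively (\<lambda>x y. (x, y) \<in> E) xs" by blast
    show ?case
    proof (cases "x \<in> set xs")
      case True
      then obtain ys zs where "xs = ys @ x # zs" by (auto dest: split_list)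
      with xs show ?thesis
        by (intro exI[of _ "x # zs"]) (auto simp: successively_append_iff)
    next
      case False
      with xs step show ?thesis
        by (intro exI[of _ "x # xs"]) (auto simp: successively_Cons)
    qed
  qed
  then show ?thesis using that by blast
qed

text \<open>Whichever vertex is deleted, \<open>a\<close> or \<open>b\<close> survives and ties the
  two remainders together.\<close>

lemma bic_on_Un:
  assumes "bic_on E A" "bic_on E B" "a \<in> A \<inter> B" "b \<in> A \<inter> B" "a \<noteq> b"
  shows "bic_on E (A \<union> B)"
proof -
  have "conn_on E ((A - {v}) \<union> (B - {v}))" for v
    using assms unfolding bic_on_def by (cases "v = a"; intro conn_on_Un) auto
  moreover have "conn_on E (A \<union> B)"
    using assms unfolding bic_on_def by (intro conn_on_Un) auto
  ultimately show ?thesis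
    using assms(1) unfolding bic_on_def by (simp add: Un_Diff)
qed

lemma bic_on_edge: "sym E \<Longrightarrow> (x, y) \<in> E \<Longrightarrow> bic_on E {x, y}"
  unfolding bic_on_def
  by (auto simp: conn_on_edge insert_Diff_if conn_on_empty conn_on_singleton)

text \<open>
  Deleting a vertex of the path leaves two pieces, each attached to \<open>S\<close> at an end of the path
  that was not deleted.
\<close>

lemma bic_on_Un_path:
  assumes "sym E" and S: "bic_on E S"
    and xs: "xs \<noteq> []" "distinct xs" "hd xs \<in> S" "last xs \<in> S"
      "successively (\<lambda>x y. (x, y) \<in> E) xs"
  shows "bic_on E (S \<union> set xs)"
proof -
  have attach: "conn_on E (T \<union> set ys)"
    if "conn_on E T" "successively (\<lambda>x y. (x, y) \<in> E) ys" "ys = [] \<or> T \<inter> set ys \<noteq> {}" for T ys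
    using that conn_on_path[OF assms(1) that(2)] by (auto intro: conn_on_Un)
  have hdlast: "hd xs \<in> set xs" "last xs \<in> set xs"
    using xs(1) by auto
  have "conn_on E (S \<union> set xs - {w})" for w
  proof (cases "w \<in> set xs")
    case True
    then obtain ys zs where split: "xs = ys @ w # zs" by (auto dest: split_list)
    have "conn_on E ((S - {w}) \<union> set ys \<union> set zs)"
    proof (intro attach)
      show "conn_on E (S - {w})" using S unfolding bic_on_def by blast
      show "successively (\<lambda>x y. (x, y) \<in> E) ys" "successively (\<lambda>x y. (x, y) \<in> E) zs"
        using xs(5) unfolding split by (auto simp: successively_append_iff successively_Cons)
      show "ys = [] \<or> (S - {w}) \<inter> set ys \<noteq> {}"
        using xs(2,3) unfolding split by (cases ys) auto
      show "zs = [] \<or> (S - {w} \<union> set ys) \<inter> set zs \<noteq> {}"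
        using xs(2,4) last_in_set[of zs] unfolding split by (auto split: if_splits)
    qed
    also have "(S - {w}) \<union> set ys \<union> set zs = S \<union> set xs - {w}"
      using xs(2) unfolding split by auto
    finally show ?thesis .
  next
    case False
    then have "S \<union> set xs - {w} = (S - {w}) \<union> set xs" by auto
    moreover have "conn_on E ((S - {w}) \<union> set xs)"
      using S xs hdlast False unfolding bic_on_def by (intro attach) auto
    ultimately show ?thesis by simp
  qed
  moreover have "conn_on E (S \<union> set xs)"
    using S xs hdlast unfolding bic_on_def by (intro attach) auto
  ultimately show ?thesis
    using S unfolding bic_on_def by auto
qed

section \<open>Biconnectedness of induced subgraphs in terms of vertex sets\<close>

lemma (in sym_digraph) sym_arcs_ends: "sym (arcs_ends G)"
  using sym_arcs unfolding symmetric_def .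

lemma (in sym_digraph) connected_iff_conn_on:
  "Digraph_Component.connected G \<longleftrightarrow> verts G \<noteq> {} \<and> conn_on (arcs_ends G) (verts G)"
proof -
  have "symcl (arcs_ends G) = arcs_ends G"
    using sym_arcs_ends unfolding symcl_def by (auto dest: symD)
  then show ?thesis
    unfolding connected_conv conn_on_def by simp
qed

text \<open>A walk that stays in \<open>S\<close> uses only arcs with both ends in \<open>S\<close>,
  and these are the arcs of the induced subgraph.\<close>

lemma conn_on_induce: "conn_on (arcs_ends (G \<restriction> S)) S \<longleftrightarrow> conn_on (arcs_ends G) S"
proof
  have "(u, v) \<in> rtrancl_on S (arcs_ends (G \<restriction> S))" if "(u, v) \<in> rtrancl_on S (arcs_ends G)" for u v
    using that
  proof induction
    case (step y z)
    then have "(y, z) \<in> arcs_ends (G \<restriction> S)" by (auto simp: arcs_ends_conv)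
    then show ?case using step by (blast intro: converse_rtrancl_on_into_rtrancl_on)
  qed simp
  then show "conn_on (arcs_ends G) S \<Longrightarrow> conn_on (arcs_ends (G \<restriction> S)) S"
    unfolding conn_on_def by blast
  have "arcs_ends (G \<restriction> S) \<subseteq> arcs_ends G" by (auto simp: arcs_ends_conv)
  then show "conn_on (arcs_ends (G \<restriction> S)) S \<Longrightarrow> conn_on (arcs_ends G) S"
    by (rule conn_on_mono[rotated])
qed

context graph begin

lemma graph_induce:
  assumes "S \<subseteq> verts G"
  shows "graph (G \<restriction> S)"
proof -
  have "induced_subgraph (G \<restriction> S) G" using assms by (rule induced_induce)
  then interpret D: digraph "G \<restriction> S" by (rule digraphI_induced)
  interpret S: sym_digraph "G \<restriction> S"
    using \<open>induced_subgraph (G \<restriction> S) G\<close> by (rule induced_graph_imp_graph)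
  show ?thesis by unfold_locales
qed

lemma connected_induce_iff:
  assumes "S \<subseteq> verts G"
  shows "Digraph_Component.connected (G \<restriction> S) \<longleftrightarrow> S \<noteq> {} \<and> conn_on (arcs_ends G) S"
proof -
  interpret S: graph "G \<restriction> S" using assms by (rule graph_induce)
  show ?thesis using S.connected_iff_conn_on by (simp add: conn_on_induce)
qed

lemma biconnected_induce_iff:
  assumes "S \<subseteq> verts G"
  shows "biconnected (G \<restriction> S) \<longleftrightarrow> bic_on (arcs_ends G) S"
proof -
  have "(G \<restriction> S) \<restriction> (S - {v}) = G \<restriction> (S - {v})" for v
    unfolding induce_subgraph_def by auto
  moreover have "S - {v} \<subseteq> verts G" for v using assms by auto
  ultimately have "biconnected (G \<restriction> S) \<longleftrightarrow> S \<noteq> {} \<and> conn_on (arcs_ends G) S \<and>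
      (\<forall>v\<in>S. S - {v} \<noteq> {} \<longrightarrow> conn_on (arcs_ends G) (S - {v}))"
    unfolding biconnected_def using graph_induce[OF assms] connected_induce_iff[OF assms]
    by (simp add: connected_induce_iff del: Diff_eq_empty_iff)
  moreover have "(\<forall>v\<in>S. S - {v} \<noteq> {} \<longrightarrow> conn_on (arcs_ends G) (S - {v})) \<longleftrightarrow>
      (\<forall>v. conn_on (arcs_ends G) (S - {v}))" if "conn_on (arcs_ends G) S"
    using that by (metis Diff_insert0 Diff_empty conn_on_empty)
  ultimately show ?thesis
    unfolding bic_on_def by blast
qed

lemma biconnected_subgraph_bic_on:
  assumes "subgraph B G" "biconnected B"
  shows "bic_on (arcs_ends G) (verts B)"
proof -
  interpret B: graph B using assms(2) unfolding biconnected_def by blast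
  have "B \<restriction> verts B = B" unfolding induce_subgraph_def by (rule pre_digraph.equality) auto
  then have "bic_on (arcs_ends B) (verts B)"
    using B.biconnected_induce_iff[of "verts B"] assms(2) by simp
  then show ?thesis using arcs_ends_mono[OF assms(1)] by (rule bic_on_mono)
qed

lemma block_subgraph: "B \<in> blocks G \<Longrightarrow> subgraph B G"
  unfolding blocks_def max_subgraph_def by simp

lemma block_bic_on: "B \<in> blocks G \<Longrightarrow> bic_on (arcs_ends G) (verts B)"
  unfolding blocks_def max_subgraph_def by (simp add: biconnected_subgraph_bic_on)

text \<open>Adding the missing arcs between vertices of \<open>B\<close> cannot destroy
  biconnectedness, so maximality says that none are missing. A block is therefore determined by its
  vertex set.\<close>

lemma block_induced:
  assumes "B \<in> blocks G"
  shows "B = G \<restriction> verts B"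
proof -
  have sub: "subgraph B G" using assms by (rule block_subgraph)
  then have V: "verts B \<subseteq> verts G" by auto
  interpret B: wf_digraph B using sub by auto
  have "biconnected (G \<restriction> verts B)"
    using block_bic_on[OF assms] V by (simp add: biconnected_induce_iff)
  moreover have "subgraph B (G \<restriction> verts B)"
    using sub by (auto simp: subgraph_def compatible_def B.wellformed)
  moreover have "subgraph (G \<restriction> verts B) G"
    using V by (rule subgraph_induce_subgraphI)
  moreover have "H = B" if "subgraph B H" "subgraph H G" "biconnected H" for H
    using assms that unfolding blocks_def max_subgraph_def by blast
  ultimately have "G \<restriction> verts B = B" by blast
  then show ?thesis by (rule sym)
qed

lemma block_maximal:
  assumes B: "B \<in> blocks G" and T: "bic_on (arcs_ends G) T" "verts B \<subseteq> T" "T \<subseteq> verts G"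
  shows "T = verts B"
proof -
  have "subgraph (G \<restriction> verts B) (G \<restriction> T)"
    using T by (auto simp: subgraph_def compatible_def)
  moreover have "biconnected (G \<restriction> T)" "subgraph (G \<restriction> T) G"
    using T by (simp_all add: biconnected_induce_iff subgraph_induce_subgraphI)
  ultimately have "G \<restriction> T = B"
    using B block_induced[OF B] unfolding blocks_def max_subgraph_def by auto
  then show ?thesis by (metis induce_subgraph_verts)
qed

text \<open>Maximality among vertex sets is enough for a block: a larger biconnected subgraph would
  have the same vertices, and the induced subgraph already contains every arc between them.\<close>

lemma bic_on_in_block:
  assumes "bic_on (arcs_ends G) S" "S \<subseteq> verts G"
  obtains B where "B \<in> blocks G" "S \<subseteq> verts B"
proof -
  let ?A = "{T. T \<subseteq> verts G \<and> bic_on (arcs_ends G) T}"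
  have "finite ?A" by simp
  then obtain T where T: "T \<in> ?A" "S \<subseteq> T" and max: "\<And>U. U \<in> ?A \<Longrightarrow> T \<subseteq> U \<Longrightarrow> T = U"
    using finite_has_maximal2[of ?A S] assms by auto
  have "G \<restriction> T \<in> blocks G"
    unfolding blocks_def max_subgraph_def
  proof (intro CollectI conjI allI impI notI; (elim conjE)?)
    show "subgraph (G \<restriction> T) G" "biconnected (G \<restriction> T)"
      using T by (simp_all add: biconnected_induce_iff subgraph_induce_subgraphI)
    fix H assume H: "H \<noteq> G \<restriction> T" "subgraph (G \<restriction> T) H" "subgraph H G" "biconnected H"
    then have V: "verts H = T"
      using max[of "verts H"] biconnected_subgraph_bic_on by fastforce
    interpret H: wf_digraph H using H(3) by auto
    have "arcs H \<subseteq> arcs (G \<restriction> T)"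
      using H(3) V H.wellformed by (auto simp: subgraph_def compatible_def)
    then have "H = G \<restriction> T"
      using H(2) V by (intro pre_digraph.equality) (auto simp: subgraph_def compatible_def)
    then show False using H(1) by blast
  qed
  with T(2) show ?thesis by (intro that[of "G \<restriction> T"]) auto
qed

lemma finite_blocks: "finite (blocks G)"
proof (rule finite_subset)
  show "blocks G \<subseteq> (\<lambda>S. G \<restriction> S) ` Pow (verts G)"
    using block_induced block_subgraph by blast
qed simp

text \<open>The two ends of an arc form a biconnected set. The block around them is induced, so it
  contains the arc and not just its ends.\<close>

lemma arc_in_block:
  assumes "e \<in> arcs G"
  obtains B where "B \<in> blocks G" "e \<in> arcs B"
proof -
  have "(tail G e, head G e) \<in> arcs_ends G"
    using assms by (auto simp: arcs_ends_conv)
  then obtain B where B: "B \<in> blocks G" "{tail G e, head G e} \<subseteq> verts B"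
    using bic_on_in_block[OF bic_on_edge[OF sym_arcs_ends]] assms by (metis empty_subsetI insert_subset wellformed)
  then have "e \<in> arcs B"
    using assms by (subst block_induced[OF B(1)]) auto
  with B(1) show ?thesis by (rule that)
qed

text \<open>Two common vertices make the union biconnected, and maximality of each block then
  equates both vertex sets with the union.\<close>

lemma blocks_eqI:
  assumes "B \<in> blocks G" "C \<in> blocks G" "a \<in> verts B \<inter> verts C" "b \<in> verts B \<inter> verts C" "a \<noteq> b"
  shows "B = C"
proof -
  have bic: "bic_on (arcs_ends G) (verts B \<union> verts C)"
    using assms by (intro bic_on_Un[of _ _ _ a b] block_bic_on) auto
  have "verts B \<union> verts C \<subseteq> verts G"
    using assms(1,2) block_subgraph by blast
  then have "verts B \<union> verts C = verts B" "verts B \<union> verts C = verts C"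
    using block_maximal[OF assms(1) bic] block_maximal[OF assms(2) bic] by blast+
  then show ?thesis using block_induced assms(1,2) by metis
qed

section \<open>Unions of blocks and their extension by one more block\<close>

lemma Union_wf:
  assumes "\<C> \<subseteq> blocks G"
  shows "wf_digraph (Union \<C>)"
proof
  fix e assume "e \<in> arcs (Union \<C>)"
  then obtain B where B: "B \<in> \<C>" "e \<in> arcs B" unfolding Union_def by auto
  then have sub: "subgraph B G" using assms block_subgraph by blast
  then have "tail G e \<in> verts B" "head G e \<in> verts B"
    using B(2) wf_digraph.wellformed[of B e] unfolding subgraph_def compatible_def by auto
  then show "tail (Union \<C>) e \<in> verts (Union \<C>)" "head (Union \<C>) e \<in> verts (Union \<C>)"
    using B(1) unfolding Union_def by auto
qed

lemma subgraph_Union: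
  assumes "\<C> \<subseteq> blocks G" "B \<in> \<C>"
  shows "subgraph B (Union \<C>)"
  using assms Union_wf[OF assms(1)] block_subgraph[of B]
  unfolding subgraph_def Union_def compatible_def by auto

lemma Union_subgraph:
  assumes "\<C> \<subseteq> blocks G"
  shows "subgraph (Union \<C>) G"
proof -
  have "\<forall>B\<in>\<C>. verts B \<subseteq> verts G \<and> arcs B \<subseteq> arcs G" using assms block_subgraph by blast
  then show ?thesis
    using Union_wf[OF assms] wf_digraph_axioms
    unfolding subgraph_def compatible_def by (auto simp: Union_def)
qed

lemma Union_sym_digraph:
  assumes "\<C> \<subseteq> blocks G"
  shows "sym_digraph (Union \<C>)"
proof -
  interpret U: wf_digraph "Union \<C>" using assms by (rule Union_wf)
  have "\<exists>f\<in>arcs (Union \<C>). tail G e = head G f \<and> head G e = tail G f" if "e \<in> arcs (Union \<C>)" for e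
  proof -
    from that obtain B where B: "B \<in> \<C>" "e \<in> arcs B" unfolding Union_def by auto
    then have "B \<in> blocks G" using assms by blast
    then have "symmetric B" "subgraph B G"
      unfolding blocks_def max_subgraph_def biconnected_def by (auto dest: graph.axioms sym_digraph.sym_arcs pseudo_graph.axioms)
    then show ?thesis
      using B unfolding symmetric_conv subgraph_def compatible_def Union_def by fastforce
  qed
  then have "symmetric (Union \<C>)"
    unfolding symmetric_conv by (simp add: Union_def)
  then show ?thesis by (rule U.sym_digraphI)
qed

lemma Union_connected_iff:
  assumes "\<C> \<subseteq> blocks G"
  shows "Digraph_Component.connected (Union \<C>) \<longleftrightarrow>
    verts (Union \<C>) \<noteq> {} \<and> conn_on (arcs_ends (Union \<C>)) (verts (Union \<C>))"
  using sym_digraph.connected_iff_conn_on[OF Union_sym_digraph[OF assms]] .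

text \<open>The union of no blocks has no vertices and so is not connected. The disjunction admits
  it as a starting point, which is the case of a graph without odd cycles.\<close>

lemma Union_insert_connected:
  assumes "insert B \<C> \<subseteq> blocks G" "\<C> = {} \<or> Digraph_Component.connected (Union \<C>) \<and> verts B \<inter> verts (Union \<C>) \<noteq> {}"
  shows "Digraph_Component.connected (Union (insert B \<C>))"
proof -
  let ?U = "Union (insert B \<C>)"
  have V: "verts ?U = verts B \<union> verts (Union \<C>)" unfolding Union_def by auto
  interpret B: graph B using assms(1) unfolding blocks_def max_subgraph_def biconnected_def by auto
  have "Digraph_Component.connected B"
    using assms(1) unfolding blocks_def max_subgraph_def biconnected_def by auto
  then have B: "verts B \<noteq> {}" "conn_on (arcs_ends B) (verts B)"
    by (simp_all add: B.connected_iff_conn_on)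
  have "conn_on (arcs_ends ?U) (verts B)"
    using B(2) arcs_ends_mono[OF subgraph_Union[OF assms(1)]] by (blast intro: conn_on_mono)
  moreover have "conn_on (arcs_ends ?U) (verts (Union \<C>))" if "\<C> \<noteq> {}"
  proof (rule conn_on_mono)
    show "conn_on (arcs_ends (Union \<C>)) (verts (Union \<C>))"
      using assms that by (simp add: Union_connected_iff)
    show "arcs_ends (Union \<C>) \<subseteq> arcs_ends ?U"
      unfolding arcs_ends_conv Union_def by auto
  qed
  moreover have "verts (Union \<C>) = {}" if "\<C> = {}" using that unfolding Union_def by simp
  ultimately have "conn_on (arcs_ends ?U) (verts B \<union> verts (Union \<C>))"
    using assms(2) by (cases "\<C> = {}") (auto intro!: conn_on_Un)
  then show ?thesis
    using B(1) by (simp add: Union_connected_iff[OF assms(1)] V)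
qed

text \<open>
  If \<open>B\<close> met the union in two vertices, a path joining them inside the union would be absorbed by
  \<open>B\<close>, so \<open>B\<close> would share an edge with one of the blocks of the union.
\<close>

lemma block_meets_Union_once:
  assumes C: "\<C> \<subseteq> blocks G" "Digraph_Component.connected (Union \<C>)"
    and B: "B \<in> blocks G" "B \<notin> \<C>"
    and uv: "u \<in> verts B \<inter> verts (Union \<C>)" "v \<in> verts B \<inter> verts (Union \<C>)"
  shows "u = v"
proof (rule ccontr)
  assume "u \<noteq> v"
  let ?K = "Union \<C>"
  have sub: "subgraph ?K G" using C(1) by (rule Union_subgraph)
  have "(u, v) \<in> rtrancl_on (verts ?K) (arcs_ends ?K)"
    using C uv by (simp add: Union_connected_iff conn_on_def)
  then obtain xs where xs: "xs \<noteq> []" "hd xs = u" "last xs = v" "distinct xs" "set xs \<subseteq> verts ?K"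
    "successively (\<lambda>x y. (x, y) \<in> arcs_ends ?K) xs"
    by (rule rtrancl_on_simple_path)
  have "successively (\<lambda>x y. (x, y) \<in> arcs_ends G) xs"
    using xs(6) by (rule successively_mono) (use arcs_ends_mono[OF sub] in auto)
  then have "bic_on (arcs_ends G) (verts B \<union> set xs)"
    using xs uv by (intro bic_on_Un_path sym_arcs_ends block_bic_on B) auto
  moreover have "verts B \<union> set xs \<subseteq> verts G"
    using xs(5) sub block_subgraph[OF B(1)] by auto
  ultimately have "verts B \<union> set xs = verts B"
    using block_maximal[OF B(1)] by blast
  then have in_B: "set xs \<subseteq> verts B" by blast
  obtain y ys where ys: "xs = u # y # ys"
    using xs(1-3) \<open>u \<noteq> v\<close> by (metis last.simps list.collapse)
  then have "(u, y) \<in> arcs_ends ?K" "u \<noteq> y" using xs(4,6) by auto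
  then obtain e where e: "e \<in> arcs ?K" "tail G e = u" "head G e = y"
    unfolding arcs_ends_conv by (auto simp: Union_def)
  then obtain B' where B': "B' \<in> \<C>" "e \<in> arcs B'" unfolding Union_def by auto
  then have "subgraph B' G" using C(1) block_subgraph by blast
  then have "u \<in> verts B'" "y \<in> verts B'"
    using e B'(2) wf_digraph.wellformed[of B' e] unfolding subgraph_def compatible_def by auto
  then have "B = B'"
    using in_B ys B(1) B'(1) C(1) \<open>u \<noteq> y\<close> by (intro blocks_eqI[of _ _ u y]) auto
  with B'(1) B(2) show False by simp
qed

text \<open>If no remaining block touched the union, its vertex set would be closed under adjacency:
  the block around an arc leaving it would touch the union, hence belong to \<open>\<C>\<close>. By
  connectedness of \<open>G\<close> the union would then contain all vertices, including those of a
  remaining block.\<close>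

lemma obtain_attached_block:
  assumes conn: "Digraph_Component.connected G"
    and C: "\<C> \<subset> blocks G" "\<C> = {} \<or> Digraph_Component.connected (Union \<C>)"
  obtains B v where "B \<in> blocks G - \<C>" "v \<in> verts B" "verts (Union \<C>) \<inter> verts B \<subseteq> {v}"
    "Digraph_Component.connected (Union (insert B \<C>))"
proof (cases "\<C> = {}")
  case True
  obtain B where B: "B \<in> blocks G - \<C>" using C(1) by blast
  obtain v where "v \<in> verts B" using block_bic_on B unfolding bic_on_def by blast
  moreover have "verts (Union \<C>) = {}" using True unfolding Union_def by simp
  moreover have "Digraph_Component.connected (Union (insert B \<C>))"
    using True B by (intro Union_insert_connected) auto
  ultimately show ?thesis using that B by blast
next
  case False
  let ?K = "Union \<C>"
  have C': "\<C> \<subseteq> blocks G" and K: "Digraph_Component.connected ?K"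
    using C False by auto
  obtain B where B: "B \<in> blocks G - \<C>" "verts B \<inter> verts ?K \<noteq> {}"
  proof (rule ccontr)
    assume none: "\<not> thesis"
    obtain B where B: "B \<in> blocks G - \<C>" using C(1) by blast
    obtain b where b: "b \<in> verts B" using block_bic_on B unfolding bic_on_def by blast
    have "b \<in> verts G" using b B block_subgraph by blast
    obtain a where a: "a \<in> verts ?K" using K C' by (auto simp: Union_connected_iff)
    then have "a \<in> verts G" using Union_subgraph[OF C'] by blast
    with \<open>b \<in> verts G\<close> have "(a, b) \<in> rtrancl_on (verts G) (arcs_ends G)"
      using conn unfolding connected_iff_conn_on conn_on_def by blast
    then have "b \<in> verts ?K"
    proof (induction rule: rtrancl_on_induct)
      case base
      show ?case by (fact a)
    next
      case (step y z)
      then obtain e where e: "e \<in> arcs G" "tail G e = y" "head G e = z"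
        unfolding arcs_ends_conv by auto
      obtain B' where B': "B' \<in> blocks G" "e \<in> arcs B'" using e(1) by (rule arc_in_block)
      have "subgraph B' G" using B'(1) by (rule block_subgraph)
      then have yz: "y \<in> verts B'" "z \<in> verts B'"
        using e B'(2) wf_digraph.wellformed[of B' e] unfolding subgraph_def compatible_def by auto
      then have "B' \<in> \<C>"
        using none that[of B'] B'(1) step.IH by blast
      with yz show ?case unfolding Union_def by auto
    qed
    with b B none that show False by blast
  qed
  then obtain v where v: "v \<in> verts B" "v \<in> verts ?K" by blast
  have "verts ?K \<inter> verts B \<subseteq> {v}"
    using block_meets_Union_once[OF C' K, of B _ v] B v by blast
  moreover have "Digraph_Component.connected (Union (insert B \<C>))"
    using B K C' by (intro Union_insert_connected) auto
  ultimately show ?thesis using that B(1) v(1) by blast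
qed

end

section \<open>Bipartiteness and the factorization\<close>

text \<open>A repeated vertex cuts the closed walk into two shorter closed walks whose lengths add
  up to an odd number, so one of them is odd.\<close>

lemma (in wf_digraph) odd_closed_walk_imp_odd_cycle:
  assumes "awalk u p u" "odd (length p)"
  shows "\<exists>q. cycle q \<and> odd (length q)"
  using assms
proof (induction "length p" arbitrary: u p rule: less_induct)
  case less
  then have "p \<noteq> []" by auto
  show ?case
  proof (cases "distinct (tl (awalk_verts u p))")
    case True
    with less.prems \<open>p \<noteq> []\<close> show ?thesis unfolding cycle_def by blast
  next
    case False
    \<comment> \<open>The start of a closed walk always recurs at its end, so \<open>cycle\<close>
      tests only the tail of the vertex list. Splitting off the first arc turns this tail into the
      vertex list of \<open>es\<close>, to which the decomposition applies.\<close>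
    obtain e es where p: "p = e # es" using \<open>p \<noteq> []\<close> by (cases p) auto
    have e: "e \<in> arcs G" "tail G e = u" and es: "awalk (head G e) es u"
      using less.prems(1) unfolding p awalk_Cons_iff by auto
    have "\<not> distinct (awalk_verts (head G e) es)" using False unfolding p by simp
    from awalk_not_distinct_decomp[OF es this] obtain q r s w where
      qrs: "es = q @ r @ s" "0 < length r" "awalk (head G e) q w" "awalk w r w" "awalk w s u"
      by blast
    show ?thesis
    proof (cases "odd (length r)")
      case True
      then show ?thesis using less.hyps[of r w] qrs p by auto
    next
      case False
      have "awalk u (e # q @ s) u"
        using e qrs by (auto simp: awalk_Cons_iff intro: awalk_appendI)
      moreover have "odd (length (e # q @ s))"
        using less.prems(2) False unfolding p qrs(1) by simp
      ultimately show ?thesis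
        using less.hyps[of "e # q @ s" u] qrs p by auto
    qed
  qed
qed

lemma (in sym_digraph) reverse_awalk:
  assumes "awalk u p v"
  shows "\<exists>q. awalk v q u \<and> length q = length p"
  using assms
proof (induction p arbitrary: u)
  case Nil
  then show ?case by (intro exI[of _ "[]"]) (auto simp: awalk_Nil_iff)
next
  case (Cons e es)
  then have e: "e \<in> arcs G" "tail G e = u" and es: "awalk (head G e) es v"
    unfolding awalk_Cons_iff by auto
  obtain f where f: "f \<in> arcs G" "tail G f = head G e" "head G f = u"
    using sym_arcs e unfolding symmetric_conv by metis
  obtain q where q: "awalk v q (head G e)" "length q = length es" using Cons.IH[OF es] by blast
  have "awalk (head G e) [f] u"
    using arc_implies_awalk[OF f(1)] f by simp
  with q show ?case by (intro exI[of _ "q @ [f]"]) (auto intro: awalk_appendI)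
qed

text \<open>The colour records whether some walk of even length from a root reaches the vertex. Of a
  walk to the tail of \<open>e\<close> and its extension by \<open>e\<close>, one is even, so at
  least one end is coloured. Even walks to both ends would close up through \<open>e\<close> to an
  odd closed walk.\<close>

lemma (in sym_digraph) bipartite_if_no_odd_cycle:
  assumes conn: "Digraph_Component.connected G" and "\<not> has_odd_cycle G"
  obtains c :: "'a \<Rightarrow> bool" where "\<And>e. e \<in> arcs G \<Longrightarrow> c (tail G e) \<noteq> c (head G e)"
proof -
  have no_odd: "even (length p)" if "awalk u p u" for u p
    using odd_closed_walk_imp_odd_cycle[OF that] assms(2) unfolding has_odd_cycle_def by blast
  obtain r where r: "r \<in> verts G"
    using conn by (auto simp: connected_def strongly_connected_def)
  define c where "c v \<longleftrightarrow> (\<exists>p. awalk r p v \<and> even (length p))" for v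
  have "c (tail G e) \<noteq> c (head G e)" if e: "e \<in> arcs G" for e
  proof -
    have e': "awalk (tail G e) [e] (head G e)" using e by (simp add: arc_implies_awalk)
    have "r \<rightarrow>\<^sup>* tail G e"
      using symmetric_connected_imp_strongly_connected[OF sym_arcs conn] r e
      by (auto simp: strongly_connected_def)
    then obtain p where p: "awalk r p (tail G e)" by (auto simp: reachable_awalk)
    have pe: "awalk r (p @ [e]) (head G e)" using p e' by (rule awalk_appendI)
    have "c (tail G e) \<or> c (head G e)"
    proof (cases "even (length p)")
      case True
      with p show ?thesis unfolding c_def by blast
    next
      case False
      then have "even (length (p @ [e]))" by simp
      with pe show ?thesis unfolding c_def by blast
    qed
    moreover have False if both: "c (tail G e)" "c (head G e)"
    proof -
      from both obtain q q' where q: "awalk r q (tail G e)" "even (length q)"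
        and q': "awalk r q' (head G e)" "even (length q')" unfolding c_def by blast
      from reverse_awalk[OF q'(1)] obtain s where s: "awalk (head G e) s r" "even (length s)"
        using q'(2) by auto
      have "awalk r (q @ [e] @ s) r"
        using q(1) e' s(1) by (blast intro: awalk_appendI)
      from no_odd[OF this] q(2) s(2) show False by simp
    qed
    ultimately show ?thesis by blast
  qed
  then show ?thesis by (rule that)
qed

text \<open>The statement is about any connected union rather than \<open>G\<^sub>0\<close>, so that
  the induction on the number of missing blocks can pass from \<open>\<C>\<close> to
  \<open>insert B \<C>\<close>.\<close>

lemma ehrhart_series_Union_blocks:
  fixes G :: "('v::finite, 'e) pre_digraph"
  assumes "graph G" "Digraph_Component.connected G"
    and "\<C> \<subseteq> blocks G" "\<C> = {} \<or> Digraph_Component.connected (pre_digraph.Union G \<C>)"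
    and "\<And>B. B \<in> blocks G - \<C> \<Longrightarrow> \<not> has_odd_cycle B"
  shows "graph_ehrhart_series G = graph_ehrhart_series (pre_digraph.Union G \<C>) *
    (\<Prod>B\<in>blocks G - \<C>. graph_ehrhart_series B)"
proof -
  interpret graph G by fact
  show ?thesis
    using assms(3-)
  proof (induction "card (blocks G - \<C>)" arbitrary: \<C> rule: less_induct)
    case less
    show ?case
    proof (cases "\<C> = blocks G")
      case True
      \<comment> \<open>The polytope is read off from arcs and their ends, so comparing arc sets is
        enough.\<close>
      have "(\<Union>B\<in>blocks G. arcs B) = arcs G"
        using block_subgraph arc_in_block by blast
      then have "graph_ehrhart_series (Union \<C>) = graph_ehrhart_series G"
        unfolding graph_ehrhart_series_def edge_polytope_def Union_def True by simp
      then show ?thesis using True by simp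
    next
      case False
      with less.prems(1) have "\<C> \<subset> blocks G" by blast
      from obtain_attached_block[OF assms(2) this less.prems(2)]
      obtain B v where B: "B \<in> blocks G - \<C>" "v \<in> verts B" "verts (Union \<C>) \<inter> verts B \<subseteq> {v}"
        and conn: "Digraph_Component.connected (Union (insert B \<C>))" .
      have sub: "subgraph B G" using B(1) block_subgraph by blast
      have "biconnected B" using B(1) unfolding blocks_def max_subgraph_def by simp
      then interpret B: graph B unfolding biconnected_def by blast
      have "Digraph_Component.connected B" "\<not> has_odd_cycle B"
        using \<open>biconnected B\<close> less.prems(3) B(1) unfolding biconnected_def by blast+
      then obtain c :: "'v \<Rightarrow> bool" where c: "\<And>e. e \<in> arcs B \<Longrightarrow> c (tail B e) \<noteq> c (head B e)"
        using B.bipartite_if_no_odd_cycle by blast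
      have "subgraph (Union \<C>) G" using less.prems(1) by (rule Union_subgraph)
      then interpret U: fin_digraph "Union \<C>" by (rule fin_digraph_subgraph)
      have "graph_ehrhart_series (Union (insert B \<C>)) =
          graph_ehrhart_series (Union \<C>) * graph_ehrhart_series B"
      proof (rule graph_ehrhart_series_glue[OF _ _ _ _ _ _ _ B(3,2) c])
        show "compatible (Union (insert B \<C>)) (Union \<C>)" "compatible (Union (insert B \<C>)) B"
          using sub unfolding Union_def subgraph_def compatible_def by auto
        show "arcs (Union (insert B \<C>)) = arcs (Union \<C>) \<union> arcs B"
          unfolding Union_def by auto
      qed (fact U.wf_digraph B.wf_digraph U.finite_arcs B.finite_arcs)+
      moreover have "graph_ehrhart_series G = graph_ehrhart_series (Union (insert B \<C>)) *
          (\<Prod>B\<in>blocks G - insert B \<C>. graph_ehrhart_series B)"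
      proof (rule less.hyps)
        show "card (blocks G - insert B \<C>) < card (blocks G - \<C>)"
          using B(1) finite_blocks by (intro psubset_card_mono) auto
      qed (use B(1) less.prems conn in auto)
      moreover have "(\<Prod>B\<in>blocks G - \<C>. graph_ehrhart_series B) =
          graph_ehrhart_series B * (\<Prod>B\<in>blocks G - insert B \<C>. graph_ehrhart_series B)"
        unfolding Diff_insert[of "blocks G" B \<C>] using finite_blocks
        by (intro prod.remove B(1)) (rule finite_Diff)
      ultimately show ?thesis
        by (metis mult.assoc)
    qed
  qed
qed

theorem theorem3p3:
  fixes G G\<^sub>0 :: "('v::finite, 'e) pre_digraph"
    and Bs :: "('v, 'e) pre_digraph set"
  assumes "graph G"
    and "Digraph_Component.connected G"
    and "biconnected_decomposition_with_oddments G G\<^sub>0 Bs"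
  shows "graph_ehrhart_series G =
    graph_ehrhart_series G\<^sub>0 * (\<Prod>B\<in>Bs. graph_ehrhart_series B)"
proof -
  interpret graph G by fact
  \<comment> \<open>Taking all blocks inside \<open>G\<^sub>0\<close>, instead of a family that
    witnesses it as a union, makes the complement exactly \<open>Bs\<close>. The union does not
    change: the witnessing family lies in \<open>\<C>\<close>, and no member of \<open>\<C>\<close>
    leaves \<open>G\<^sub>0\<close>.\<close>
  define \<C> where "\<C> = {B \<in> blocks G. subgraph B G\<^sub>0}"
  have part: "is_oddment_part G G\<^sub>0" and Bs: "Bs = blocks G - \<C>"
    using assms(3) unfolding biconnected_decomposition_with_oddments_def \<C>_def by auto
  obtain \<B> where \<B>: "\<B> \<subseteq> blocks G" "G\<^sub>0 = Union \<B>"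
    using part unfolding is_oddment_part_def connected_odd_block_unions_def
    by (cases "has_odd_cycle G") auto
  have "\<B> \<subseteq> \<C>"
    unfolding \<C>_def \<B>(2) using \<B>(1) subgraph_Union by blast
  have "\<forall>B\<in>\<C>. verts B \<subseteq> verts G\<^sub>0 \<and> arcs B \<subseteq> arcs G\<^sub>0"
    unfolding \<C>_def by auto
  with \<open>\<B> \<subseteq> \<C>\<close> have G\<^sub>0: "Union \<C> = G\<^sub>0"
    unfolding \<B>(2) by (auto simp: Union_def)
  have "\<C> = {} \<or> Digraph_Component.connected (Union \<C>)"
  proof (cases "has_odd_cycle G")
    case True
    then show ?thesis
      using part unfolding is_oddment_part_def connected_odd_block_unions_def G\<^sub>0 by auto
  next
    case False
    \<comment> \<open>Blocks have vertices, so none fits into the empty \<open>G\<^sub>0\<close>,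
      and the induction starts from no blocks at all.\<close>
    then have "verts G\<^sub>0 = {}" using part unfolding is_oddment_part_def by (simp add: Union_def)
    moreover have "verts B \<noteq> {}" if "B \<in> \<C>" for B
      using that block_bic_on[of B] unfolding \<C>_def bic_on_def by blast
    ultimately show ?thesis unfolding \<C>_def by blast
  qed
  moreover have "\<not> has_odd_cycle B" if "B \<in> blocks G - \<C>" for B
  proof (cases "has_odd_cycle G")
    case True
    then show ?thesis
      using part that unfolding is_oddment_part_def connected_odd_block_unions_def \<C>_def by auto
  next
    case False
    then show ?thesis
      using that subgraph_cycle[OF block_subgraph] unfolding has_odd_cycle_def by blast
  qed
  moreover have "\<C> \<subseteq> blocks G" unfolding \<C>_def by blast
  ultimately show ?thesis
    unfolding Bs G\<^sub>0[symmetric] by (intro ehrhart_series_Union_blocks assms(1,2))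
qed

end
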